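(* Let $X,\Delta$ satisfy $\Delta X-qX\Delta=1$, and let $\mathfrak h$ be a polynomial with normal form $$\mathfrak{h}=\sum_{(r,s)\in\mathcal H}w_{r,s}X^r\Delta^s,$$ where $\mathcal H\subset\mathbb Z_{\ge0}\times\mathbb Z_{\ge0}$ is finite and the $w_{r,s}$ are weights. For $n\geq 0$ write the normal form of the power $\mathfrak h^n$ as $$\mathfrak N(\mathfrak h^n)=\sum_{a,b}c_{n,a,b}(q)\,X^a\Delta^b .$$ Then the polynomial $c_{n,a,b}(q)$ coincides with the total weight of the labelled embedded diagrams that admit $\mathcal H$ as a basis weighted by $w$, have size $n$, and have $a$ outputs and $b$ inputs, where the variable $q$ marks the number of crossings; that is, $c_{n,a,b}(q)=\sum_\delta w(\delta)\,q^{\mathrm{cr}(\delta)}$, the sum being over all such diagrams $\delta$, with $w(\delta)$ the weight and $\mathrm{cr}(\delta)$ the crossing number of $\delta$.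
   Context: Operators: $X$ is multiplication by $x$, $(Xf)(x)=xf(x)$, and $\Delta=\Delta_q$ is the $q$-difference operator $\Delta f(x)=\frac{f(qx)-f(x)}{(q-1)x}$, so $\Delta X-qX\Delta=1$. The normal form $\mathfrak N$ (all $X$'s to the left of all $\Delta$'s) is obtained by iterating the rewrite rule $\Delta X\to1+qX\Delta$; its coefficients are polynomials in $q$ (the weights $w_{r,s}$ being independent of $q$). Labelled diagrams with basis $\mathcal H$: a labelled diagram of size $n$ has inner nodes (gates) labelled $1,\dots,n$, node $j$ being a gate of some type $(r_j,s_j)\in\mathcal H$ with $r_j$ ordered output slots and $s_j$ ordered input slots, together with a set of connections, each joining an output slot of a node $i$ to an input slot of a node $j$ with $i<j$, every slot being used at most once. Unconnected output slots are the outputs, unconnected input slots the inputs. The weight $w(\delta)$ is the product of the $w_{r_j,s_j}$ over the gates. Embedded diagrams and crossings: the diagram is drawn in the plane with all edges made of segments or half-lines parallel to the axes. The gates are added in increasing order of labels, each new gate being placed to the north-west of the diagram formed by the gates with smaller labels. Each output slot of a gate has its own vertical line going upwards from the gate; each input slot of a gate has its own horizontal line going to the right from the gate. Thus the vertical lines of a gate lie to the left of all vertical lines of gates with smaller labels, and its horizontal lines lie above all horizontal lines of gates with smaller labels; within a gate, the horizontal lines are stacked from bottom to top in the order of its inputs (the first input corresponding to the first application of $\Delta$, i.e. being the lowest), and the lines of a gate do not cross other lines of the same gate on leaving it. An edge connecting an output of gate $i$ to an input of gate $j>i$ goes up along the vertical line of the output until it meets the horizontal line of the input, then follows that horizontal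 line leftwards to gate $j$. An unconnected input is prolonged as a horizontal half-line to the right; an unconnected output is prolonged as a vertical half-line upwards. The crossing number of the embedded diagram is the number of pairs of edges (half-lines included) that cross. *)

theory Defs
  imports "HOL-Library.Poly_Mapping" "HOL-Library.FuncSet"
    "HOL-Computational_Algebra.Polynomial" Complex_Main
begin

section \<open>Polynomials in $X$ and $\Delta$, and their normal form\<close>

text \<open>
  Words in two letters under concatenation, written additively because the product of
  \<^type>\<open>poly_mapping\<close> is the monoid algebra of an additive monoid of exponents.
\<close>

datatype letter = LX | LD

datatype op_word = Word (letters: "letter list")

instantiation op_word :: monoid_add
begin
definition zero_op_word :: op_word where "0 = Word []"
definition plus_op_word :: "op_word \<Rightarrow> op_word \<Rightarrow> op_word"
  where "u + v = Word (letters u @ letters v)"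
instance by standard (simp_all add: zero_op_word_def plus_op_word_def)
end

text \<open>
  The free associative algebra on $X, \Delta$ over $R[q]$, where $R$ is the commutative ring
  \<^typ>\<open>'a\<close> of weights and $R[q]$ is \<^typ>\<open>'a poly\<close>.
\<close>

type_synonym 'a op_poly = "op_word \<Rightarrow>\<^sub>0 'a poly"

definition qvar :: "'a::comm_ring_1 poly" where "qvar = [:0, 1:]"

definition scalar :: "'a::comm_ring_1 poly \<Rightarrow> 'a op_poly"
  where "scalar c = Poly_Mapping.single 0 c"

definition opX :: "'a::comm_ring_1 op_poly"
  where "opX = Poly_Mapping.single (Word [LX]) 1"

definition opD :: "'a::comm_ring_1 op_poly"
  where "opD = Poly_Mapping.single (Word [LD]) 1"

text \<open>
  One application of $\Delta X \to 1 + q X \Delta$: an occurrence of the factor $\Delta X$ in a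
  word of the support is replaced, the coefficient of that word being carried along.
\<close>

inductive rewrite_step :: "'a::comm_ring_1 op_poly \<Rightarrow> 'a op_poly \<Rightarrow> bool" where
  "c = Poly_Mapping.lookup p (u + Word [LD, LX] + v) \<Longrightarrow> c \<noteq> 0 \<Longrightarrow>
   rewrite_step p
     (p - Poly_Mapping.single (u + Word [LD, LX] + v) c
        + Poly_Mapping.single (u + v) c
        + Poly_Mapping.single (u + Word [LX, LD] + v) (c * qvar))"

definition normal_word :: "nat \<Rightarrow> nat \<Rightarrow> op_word"
  where "normal_word a b = Word (replicate a LX @ replicate b LD)"

definition is_normal :: "'a::comm_ring_1 op_poly \<Rightarrow> bool"
  where "is_normal p \<longleftrightarrow> (\<forall>u \<in> Poly_Mapping.keys p. \<exists>a b. u = normal_word a b)"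

definition normal_form :: "'a::comm_ring_1 op_poly \<Rightarrow> 'a op_poly"
  where "normal_form p = (THE N. rewrite_step\<^sup>*\<^sup>* p N \<and> is_normal N)"

definition nf_coeff :: "'a::comm_ring_1 op_poly \<Rightarrow> nat \<Rightarrow> nat \<Rightarrow> 'a poly"
  where "nf_coeff p a b = Poly_Mapping.lookup (normal_form p) (normal_word a b)"


subsection \<open>Existence and uniqueness of the normal form\<close>

fun inversions :: "letter list \<Rightarrow> nat" where
  "inversions [] = 0"
| "inversions (LX # u) = inversions u"
| "inversions (LD # u) = inversions u + count_list u LX"

lemma inversions_append:
  "inversions (u @ v) = inversions u + inversions v + count_list u LD * count_list v LX"
  by (induction u rule: inversions.induct) (auto simp: algebra_simps)

lemma normal_or_factor:
  "(\<exists>a b. w = replicate a LX @ replicate b LD) \<or> (\<exists>u v. w = u @ [LD, LX] @ v)"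
proof (induction w)
  case Nil
  have "[] = replicate 0 LX @ replicate 0 LD" by simp
  then show ?case by blast
next
  case (Cons x w)
  show ?case
  proof (cases "\<exists>u v. w = u @ [LD, LX] @ v")
    case True
    then obtain u v where "x # w = (x # u) @ [LD, LX] @ v" by auto
    then show ?thesis by blast
  next
    case False
    then obtain a b where w: "w = replicate a LX @ replicate b LD" using Cons by blast
    show ?thesis
    proof (cases x)
      case LX
      then have "x # w = replicate (Suc a) LX @ replicate b LD" using w by simp
      then show ?thesis by blast
    next
      case LD
      show ?thesis
      proof (cases a)
        case 0
        then have "x # w = replicate 0 LX @ replicate (Suc b) LD" using w LD by simp
        then show ?thesis by blast
      next
        case (Suc a')
        then have "x # w = [] @ [LD, LX] @ (replicate a' LX @ replicate b LD)"
          using w LD by simp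
        then show ?thesis by blast
      qed
    qed
  qed
qed

lemma not_normal_factor:
  assumes "\<nexists>a b. w = normal_word a b"
  obtains u v where "w = u + Word [LD, LX] + v"
proof -
  obtain u v where "letters w = u @ [LD, LX] @ v"
    using normal_or_factor[of "letters w"] assms
    by (metis normal_word_def op_word.collapse)
  then have "w = Word u + Word [LD, LX] + Word v"
    by (metis append_assoc op_word.collapse op_word.sel plus_op_word_def)
  then show ?thesis using that by blast
qed

lemma normal_form_exists_aux:
  fixes p :: "'a::comm_ring_1 op_poly"
  assumes "\<And>w. w \<in> Poly_Mapping.keys p \<Longrightarrow> (\<nexists>a b. w = normal_word a b)
             \<Longrightarrow> inversions (letters w) < m"
  shows "\<exists>N. rewrite_step\<^sup>*\<^sup>* p N \<and> is_normal N"
  using assms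
proof (induction m arbitrary: p)
  case 0
  then show ?case unfolding is_normal_def by blast
next
  case (Suc m)
  define bad where "bad p = {w \<in> Poly_Mapping.keys p. (\<nexists>a b. w = normal_word a b)
      \<and> inversions (letters w) = m}" for p :: "'a op_poly"
  have fin: "finite (bad p)" for p unfolding bad_def by simp
  from Suc.prems show ?case
  proof (induction "card (bad p)" arbitrary: p rule: less_induct)
    case less
    show ?case
    proof (cases "bad p = {}")
      case True
      have "inversions (letters w) < m"
        if "w \<in> Poly_Mapping.keys p" "\<nexists>a b. w = normal_word a b" for w
        using less.prems[OF that] True that unfolding bad_def by (auto simp: less_Suc_eq)
      then show ?thesis using Suc.IH by blast
    next
      case False
      then obtain w where w: "w \<in> Poly_Mapping.keys p" "\<nexists>a b. w = normal_word a b"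
        "inversions (letters w) = m" unfolding bad_def by blast
      obtain u v where uv: "w = u + Word [LD, LX] + v" using not_normal_factor[OF w(2)] .
      define c where "c = Poly_Mapping.lookup p w"
      have c: "c \<noteq> 0" using w(1) unfolding c_def by (simp add: in_keys_iff)
      define p' where "p' = p - Poly_Mapping.single w c + Poly_Mapping.single (u + v) c
        + Poly_Mapping.single (u + Word [LX, LD] + v) (c * qvar)"
      have step: "rewrite_step p p'"
        unfolding p'_def uv using c by (intro rewrite_step.intros) (simp_all add: c_def uv)
      have inv1: "inversions (letters (u + v)) < m"
        using w(3) unfolding uv by (simp add: plus_op_word_def inversions_append algebra_simps)
      have inv2: "inversions (letters (u + Word [LX, LD] + v)) < m"
        using w(3) unfolding uv by (simp add: plus_op_word_def inversions_append algebra_simps)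
      have keys: "z \<in> Poly_Mapping.keys p \<and> z \<noteq> w"
        if "z \<in> Poly_Mapping.keys p'" "\<not> inversions (letters z) < m" for z
      proof -
        have ne: "z \<noteq> u + v" "z \<noteq> u + Word [LX, LD] + v" using that(2) inv1 inv2 by auto
        have "Poly_Mapping.lookup p' z = Poly_Mapping.lookup p z
            - Poly_Mapping.lookup (Poly_Mapping.single w c) z"
          unfolding p'_def using ne by (simp add: lookup_add lookup_minus lookup_single_not_eq)
        then show ?thesis using that(1)
          by (cases "z = w") (auto simp: in_keys_iff lookup_single_not_eq c_def)
      qed
      have "bad p' \<subseteq> bad p - {w}" using keys unfolding bad_def by auto
      moreover have "w \<in> bad p" using w unfolding bad_def by blast
      ultimately have "card (bad p') < card (bad p)"
        by (intro psubset_card_mono fin) blast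
      moreover have "inversions (letters z) < Suc m"
        if "z \<in> Poly_Mapping.keys p'" "\<nexists>a b. z = normal_word a b" for z
        using keys[OF that(1)] less.prems that(2) by (meson less_SucI)
      ultimately obtain N where "rewrite_step\<^sup>*\<^sup>* p' N" "is_normal N"
        using less.hyps[of p'] by blast
      then show ?thesis using step by (meson converse_rtranclp_into_rtranclp)
    qed
  qed
qed

lemma normal_form_exists: "\<exists>N. rewrite_step\<^sup>*\<^sup>* p N \<and> is_normal N"
proof (rule normal_form_exists_aux)
  fix w assume "w \<in> Poly_Mapping.keys p"
  then have "inversions (letters w) \<le> Max ((\<lambda>w. inversions (letters w)) ` Poly_Mapping.keys p)"
    by (intro Max_ge) auto
  then show "inversions (letters w) <
      Suc (Max ((\<lambda>w. inversions (letters w)) ` Poly_Mapping.keys p))" by simp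
qed

text \<open>
  The coefficient of $X^a\Delta^b$ in the normal form of a word, computed letter by letter from
  $\Delta X^a = [a]_q X^{a-1} + q^a X^a \Delta$; it is an invariant of rewriting.
\<close>

fun word_coeff :: "letter list \<Rightarrow> nat \<Rightarrow> nat \<Rightarrow> 'a::comm_ring_1 poly" where
  "word_coeff [] a b = (if a = 0 \<and> b = 0 then 1 else 0)"
| "word_coeff (LX # u) a b = (if a = 0 then 0 else word_coeff u (a - 1) b)"
| "word_coeff (LD # u) a b = (\<Sum>i<Suc a. qvar ^ i) * word_coeff u (Suc a) b
     + qvar ^ a * (if b = 0 then 0 else word_coeff u a (b - 1))"

lemma word_coeff_rewrite:
  "word_coeff (u @ LD # LX # v) a b =
     word_coeff (u @ v) a b + qvar * word_coeff (u @ LX # LD # v) a b"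
proof (induction u arbitrary: a b)
  case Nil
  show ?case
  proof (cases a)
    case 0
    then show ?thesis by simp
  next
    case (Suc k)
    have "(\<Sum>i<Suc (Suc k). qvar ^ i) = 1 + qvar * (\<Sum>i<Suc k. qvar ^ i :: 'a poly)"
      by (subst sum.lessThan_Suc_shift) (simp add: sum_distrib_left algebra_simps)
    then show ?thesis using Suc
      by (simp del: sum.lessThan_Suc add: algebra_simps)
  qed
next
  case (Cons x u)
  show ?case by (cases x) (simp_all add: Cons.IH algebra_simps del: sum.lessThan_Suc)
qed

lemma word_coeff_normal:
  "word_coeff (replicate c LX @ replicate d LD) a b = (if a = c \<and> b = d then 1 else 0)"
proof (induction c arbitrary: a)
  case 0
  show ?case by (induction d arbitrary: a b) (auto simp del: sum.lessThan_Suc)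
next
  case (Suc c)
  then show ?case by (cases a) auto
qed

definition inv_coeff :: "nat \<Rightarrow> nat \<Rightarrow> 'a::comm_ring_1 op_poly \<Rightarrow> 'a poly" where
  "inv_coeff a b p =
     (\<Sum>w\<in>Poly_Mapping.keys p. Poly_Mapping.lookup p w * word_coeff (letters w) a b)"

lemma inv_coeff_superset:
  assumes "finite S" "Poly_Mapping.keys p \<subseteq> S"
  shows "inv_coeff a b p = (\<Sum>w\<in>S. Poly_Mapping.lookup p w * word_coeff (letters w) a b)"
  unfolding inv_coeff_def
  by (rule sum.mono_neutral_left) (use assms in \<open>auto simp: in_keys_iff\<close>)

lemma inv_coeff_single: "inv_coeff a b (Poly_Mapping.single w c) = c * word_coeff (letters w) a b"
  by (simp add: inv_coeff_def)

lemma inv_coeff_add: "inv_coeff a b (p + p') = inv_coeff a b p + inv_coeff a b p'"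
proof -
  let ?S = "Poly_Mapping.keys p \<union> Poly_Mapping.keys p'"
  have "Poly_Mapping.keys (p + p') \<subseteq> ?S" by (rule keys_add)
  then show ?thesis
    by (simp add: inv_coeff_superset[of ?S] lookup_add sum.distrib algebra_simps)
qed

lemma inv_coeff_diff: "inv_coeff a b (p - p') = inv_coeff a b p - inv_coeff a b p'"
  using inv_coeff_add[of a b "p - p'" p'] by simp

lemma inv_coeff_step: "rewrite_step p p' \<Longrightarrow> inv_coeff a b p' = inv_coeff a b p"
  by (induction rule: rewrite_step.induct)
    (simp add: inv_coeff_add inv_coeff_diff inv_coeff_single plus_op_word_def
      word_coeff_rewrite algebra_simps)

lemma inv_coeff_steps: "rewrite_step\<^sup>*\<^sup>* p p' \<Longrightarrow> inv_coeff a b p' = inv_coeff a b p"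
  by (induction rule: rtranclp_induct) (simp_all add: inv_coeff_step)

lemma inv_coeff_normal:
  assumes "is_normal N"
  shows "inv_coeff a b N = Poly_Mapping.lookup N (normal_word a b)"
proof -
  let ?S = "insert (normal_word a b) (Poly_Mapping.keys N)"
  have "inv_coeff a b N = (\<Sum>w\<in>?S. Poly_Mapping.lookup N w * word_coeff (letters w) a b)"
    by (rule inv_coeff_superset) auto
  also have "\<dots> = (\<Sum>w\<in>?S. if w = normal_word a b then Poly_Mapping.lookup N w else 0)"
  proof (rule sum.cong[OF refl])
    fix w assume "w \<in> ?S"
    then obtain c d where w: "w = normal_word c d" using assms unfolding is_normal_def by blast
    have "word_coeff (letters w) c d = (1 :: 'a poly)"
      by (simp add: w normal_word_def word_coeff_normal)
    moreover have "word_coeff (letters w) a b = (if a = c \<and> b = d then 1 else (0 :: 'a poly))"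
      by (simp add: w normal_word_def word_coeff_normal)
    moreover have "(a = c \<and> b = d) \<longleftrightarrow> w = normal_word a b"
    proof
      assume "w = normal_word a b"
      then have "word_coeff (letters w) c d = (if c = a \<and> d = b then 1 else (0 :: 'a poly))"
        by (simp add: normal_word_def word_coeff_normal)
      then show "a = c \<and> b = d" using calculation(1) by (simp split: if_splits)
    qed (simp add: w)
    ultimately show "Poly_Mapping.lookup N w * word_coeff (letters w) a b =
        (if w = normal_word a b then Poly_Mapping.lookup N w else 0)" by simp
  qed
  also have "\<dots> = Poly_Mapping.lookup N (normal_word a b)" by (simp add: sum.delta)
  finally show ?thesis .
qed

lemma normal_eqI:
  assumes "is_normal N" "is_normal N'"
    and "\<And>a b. Poly_Mapping.lookup N (normal_word a b) = Poly_Mapping.lookup N' (normal_word a b)"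
  shows "N = N'"
proof (rule poly_mapping_eqI)
  fix w
  show "Poly_Mapping.lookup N w = Poly_Mapping.lookup N' w"
    using assms unfolding is_normal_def by (metis in_keys_iff)
qed

theorem ex1_normal_form: "\<exists>!N. rewrite_step\<^sup>*\<^sup>* p N \<and> is_normal N"
proof -
  have "N = N'" if "rewrite_step\<^sup>*\<^sup>* p N \<and> is_normal N" "rewrite_step\<^sup>*\<^sup>* p N' \<and> is_normal N'" for N N'
    using that by (intro normal_eqI) (metis inv_coeff_normal inv_coeff_steps)+
  then show ?thesis using normal_form_exists by blast
qed

lemma normal_form_steps: "rewrite_step\<^sup>*\<^sup>* p (normal_form p)"
  and normal_form_normal: "is_normal (normal_form p)"
  using theI'[OF ex1_normal_form[of p]] unfolding normal_form_def by blast+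

lemma normal_form_eqI: "rewrite_step\<^sup>*\<^sup>* p N \<Longrightarrow> is_normal N \<Longrightarrow> normal_form p = N"
  using ex1_normal_form[of p] normal_form_steps[of p] normal_form_normal[of p] by blast

lemma nf_coeff_eq_inv_coeff: "nf_coeff p a b = inv_coeff a b p"
  unfolding nf_coeff_def
  by (metis inv_coeff_normal inv_coeff_steps normal_form_normal normal_form_steps)

lemma opX_opD_power: "opX ^ a * opD ^ b = Poly_Mapping.single (normal_word a b) 1"
proof -
  have X: "opX ^ n = Poly_Mapping.single (Word (replicate n LX)) 1" for n
    by (induction n) (simp_all add: opX_def mult_single plus_op_word_def flip: zero_op_word_def)
  have D: "opD ^ n = Poly_Mapping.single (Word (replicate n LD)) 1" for n
    by (induction n) (simp_all add: opD_def mult_single plus_op_word_def flip: zero_op_word_def)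
  show ?thesis by (simp add: X D mult_single plus_op_word_def normal_word_def)
qed

lemma normal_form_commutation: "normal_form (opD * opX - scalar qvar * opX * opD) = 1"
proof (rule normal_form_eqI)
  let ?p = "opD * opX - scalar qvar * opX * opD :: 'a op_poly"
  have p: "?p = Poly_Mapping.single (Word [LD, LX]) 1 - Poly_Mapping.single (Word [LX, LD]) qvar"
    by (simp add: opX_def opD_def scalar_def mult_single plus_op_word_def zero_op_word_def)
  have l: "1 = Poly_Mapping.lookup ?p (0 + Word [LD, LX] + 0)"
    by (simp add: p lookup_minus lookup_single_not_eq)
  have "rewrite_step ?p (?p - Poly_Mapping.single (0 + Word [LD, LX] + 0) 1
      + Poly_Mapping.single (0 + 0) 1 + Poly_Mapping.single (0 + Word [LX, LD] + 0) (1 * qvar))"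
    using l by (rule rewrite_step.intros) simp
  also have "?p - Poly_Mapping.single (0 + Word [LD, LX] + 0) 1
      + Poly_Mapping.single (0 + 0) 1 + Poly_Mapping.single (0 + Word [LX, LD] + 0) (1 * qvar) = 1"
    by (simp add: p)
  finally show "rewrite_step\<^sup>*\<^sup>* ?p 1" by blast
  have "0 = normal_word 0 0" by (simp add: normal_word_def zero_op_word_def)
  then show "is_normal (1 :: 'a op_poly)" unfolding is_normal_def by (metis keys_one singletonD)
qed


section \<open>Labelled diagrams\<close>

text \<open>
  A slot $(j, k)$ is the $k$-th output slot, or the $k$-th input slot, of gate $j$; slots are
  numbered from 1.  A diagram of size $n$ is the map sending each label to the type of its gate,
  together with the set of its connections, a connection being a pair of an output slot and an
  input slot.  The map is \<^const>\<open>undefined\<close> outside $\{1,\dots,n\}$, so that equal diagrams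
  are equal as values.
\<close>

type_synonym slot = "nat \<times> nat"

type_synonym diagram = "(nat \<Rightarrow> nat \<times> nat) \<times> (slot \<times> slot) set"

abbreviation gate_type :: "diagram \<Rightarrow> nat \<Rightarrow> nat \<times> nat" where "gate_type \<equiv> fst"
abbreviation connections :: "diagram \<Rightarrow> (slot \<times> slot) set" where "connections \<equiv> snd"
abbreviation n_out :: "diagram \<Rightarrow> nat \<Rightarrow> nat" where "n_out \<delta> j \<equiv> fst (gate_type \<delta> j)"
abbreviation n_in :: "diagram \<Rightarrow> nat \<Rightarrow> nat" where "n_in \<delta> j \<equiv> snd (gate_type \<delta> j)"

definition out_slots :: "nat \<Rightarrow> diagram \<Rightarrow> slot set"
  where "out_slots n \<delta> = (SIGMA j:{1..n}. {1..n_out \<delta> j})"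

definition in_slots :: "nat \<Rightarrow> diagram \<Rightarrow> slot set"
  where "in_slots n \<delta> = (SIGMA j:{1..n}. {1..n_in \<delta> j})"

definition labelled_diagrams :: "(nat \<times> nat) set \<Rightarrow> nat \<Rightarrow> diagram set" where
  "labelled_diagrams \<H> n = {\<delta>.
     gate_type \<delta> \<in> {1..n} \<rightarrow>\<^sub>E \<H> \<and>
     connections \<delta> \<subseteq> out_slots n \<delta> \<times> in_slots n \<delta> \<and>
     (\<forall>((i, k), (j, l)) \<in> connections \<delta>. i < j) \<and>
     inj_on fst (connections \<delta>) \<and> inj_on snd (connections \<delta>)}"

definition outputs :: "nat \<Rightarrow> diagram \<Rightarrow> slot set"
  where "outputs n \<delta> = out_slots n \<delta> - fst ` connections \<delta>"

definition inputs :: "nat \<Rightarrow> diagram \<Rightarrow> slot set"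
  where "inputs n \<delta> = in_slots n \<delta> - snd ` connections \<delta>"

definition weight :: "(nat \<times> nat \<Rightarrow> 'a::comm_ring_1) \<Rightarrow> nat \<Rightarrow> diagram \<Rightarrow> 'a"
  where "weight w n \<delta> = (\<Prod>j\<in>{1..n}. w (gate_type \<delta> j))"


section \<open>Embedding in the plane and crossings\<close>

text \<open>
  Gate $j$ is drawn as the box
  \<open>[gate_right j - (n_out j + 1), gate_right j] \<times> [gate_bottom j, gate_bottom j + n_in j + 1]\<close>,
  whose lower right corner is the upper left corner of the box of gate $j - 1$.  Outputs leave
  upwards from the top side, inputs leave to the right from the right side, at unit distances;
  hence the lines of one gate do not meet on leaving it.  Inputs are stacked from bottom to top;
  outputs are placed from left to right.
\<close>

definition gate_right :: "diagram \<Rightarrow> nat \<Rightarrow> real"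
  where "gate_right \<delta> j = - (\<Sum>m\<in>{1..<j}. real (n_out \<delta> m) + 1)"

definition gate_bottom :: "diagram \<Rightarrow> nat \<Rightarrow> real"
  where "gate_bottom \<delta> j = (\<Sum>m\<in>{1..<j}. real (n_in \<delta> m) + 1)"

definition gate_left :: "diagram \<Rightarrow> nat \<Rightarrow> real"
  where "gate_left \<delta> j = gate_right \<delta> j - (real (n_out \<delta> j) + 1)"

definition gate_top :: "diagram \<Rightarrow> nat \<Rightarrow> real"
  where "gate_top \<delta> j = gate_bottom \<delta> j + (real (n_in \<delta> j) + 1)"

definition out_x :: "diagram \<Rightarrow> slot \<Rightarrow> real"
  where "out_x \<delta> = (\<lambda>(j, k). gate_left \<delta> j + real k)"

definition in_y :: "diagram \<Rightarrow> slot \<Rightarrow> real"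
  where "in_y \<delta> = (\<lambda>(j, l). gate_bottom \<delta> j + real l)"

datatype edge = Connection slot slot | Output slot | Input slot

definition edges :: "nat \<Rightarrow> diagram \<Rightarrow> edge set" where
  "edges n \<delta> = (\<lambda>(out, inp). Connection out inp) ` connections \<delta>
     \<union> Output ` outputs n \<delta> \<union> Input ` inputs n \<delta>"

fun curve :: "diagram \<Rightarrow> edge \<Rightarrow> (real \<times> real) set" where
  "curve \<delta> (Connection out inp) =
     {out_x \<delta> out} \<times> {gate_top \<delta> (fst out)..in_y \<delta> inp}
     \<union> {gate_right \<delta> (fst inp)..out_x \<delta> out} \<times> {in_y \<delta> inp}"
| "curve \<delta> (Output out) = {out_x \<delta> out} \<times> {gate_top \<delta> (fst out)..}"
| "curve \<delta> (Input inp) = {gate_right \<delta> (fst inp)..} \<times> {in_y \<delta> inp}"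

text \<open>
  Distinct edges use distinct vertical and distinct horizontal lines, and no edge ends on another
  one, so two edges cross as soon as they have a common point.
\<close>

definition crossings :: "nat \<Rightarrow> diagram \<Rightarrow> nat" where
  "crossings n \<delta> = card {{e, f} | e f.
     e \<in> edges n \<delta> \<and> f \<in> edges n \<delta> \<and> e \<noteq> f \<and> curve \<delta> e \<inter> curve \<delta> f \<noteq> {}}"

end

theory Submission
  imports Defs
begin

text \<open>
  Expanding \<open>h\<^sup>n\<close> with \<open>h\<close> in normal form gives one word
  \<open>X\<^sup>r\<Delta>\<^sup>s \<dots> X\<^sup>r\<Delta>\<^sup>s\<close> for each choice of the types of \<open>n\<close> gates.  The gates are
  read from label \<open>n\<close> down to label 1, because each new gate is placed to the north-west of
  the older ones and acts after them, that is, as a factor on the left.  The letters of the word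
  are then the slots: a letter \<open>X\<close> is an output, a letter \<open>\<Delta>\<close> is an input, the outputs
  stand in the word in the order of their vertical lines from left to right, and the inputs in the
  order of their horizontal lines from top to bottom.  An output slot belongs to a gate with a
  smaller label than an input slot exactly if its \<open>X\<close> is to the right of the \<open>\<Delta>\<close>.  So
  the admissible sets of connections are the partial matchings of letters \<open>\<Delta>\<close> with letters
  \<open>X\<close> further right.

  The normal form of one word is a sum over these matchings
  (\<open>word_coeff_eq_sum_matchings\<close>).  When a \<open>\<Delta>\<close> is put in front of a word with \<open>a\<close>
  unmatched letters \<open>X\<close>, the identity
  \<open>\<Delta>X\<^sup>a = (1 + q + \<dots> + q\<^bsup>a-1\<^esup>) X\<^bsup>a-1\<^esup> + q\<^sup>a X\<^sup>a \<Delta>\<close> is a case distinction: the horizontal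
  line of the new input either ends at one of the \<open>a\<close> free vertical lines, having crossed those
  to the left of it, or it crosses all \<open>a\<close> of them and stays an input.  Vertical lines that are
  already connected to lower inputs are not met.

  The rest is the translation of the geometric crossing number into this count
  (\<open>crossings_eq_card_cross_pairs\<close>).  Vertical pieces of distinct edges lie on distinct lines, and
  so do horizontal pieces, so that a crossing is a vertical piece of one edge meeting a horizontal
  piece of another one.  These two roles cannot be exchanged in the same pair of edges, since the
  vertical line of the first edge is to the left of any vertical line of the second one; hence a crossing
  amounts to one output slot and one input slot.
\<close>

section \<open>Normal ordering of one word\<close>

text \<open>
  A set \<open>S\<close> of pairs (letter, name) stands for a word with distinct letters; the relation
  \<open>prec\<close> says which letter is further left.  Keeping the order apart from the set makes matchings
  and crossings independent of any numbering of positions, so that connections of a diagram are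
  matchings literally and not only up to a bijection.
\<close>

locale slot_order =
  fixes prec :: "letter \<times> 's \<Rightarrow> letter \<times> 's \<Rightarrow> bool"
  assumes prec_asym: "prec p p' \<Longrightarrow> \<not> prec p' p"
    and prec_trans: "prec p p' \<Longrightarrow> prec p' p'' \<Longrightarrow> prec p p''"
    and prec_total: "p \<noteq> p' \<Longrightarrow> prec p p' \<or> prec p' p"
begin

definition matchings :: "(letter \<times> 's) set \<Rightarrow> ('s \<times> 's) set set" where
  "matchings S = {M. (\<forall>(x, d) \<in> M. (LX, x) \<in> S \<and> (LD, d) \<in> S \<and> prec (LD, d) (LX, x))
     \<and> inj_on fst M \<and> inj_on snd M}"

definition free :: "letter \<Rightarrow> (letter \<times> 's) set \<Rightarrow> 's set \<Rightarrow> 's set"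
  where "free c S T = {x. (c, x) \<in> S} - T"

text \<open>
  The pair \<open>(x, d)\<close> records that the vertical line of \<open>x\<close> crosses the horizontal line of
  \<open>d\<close>.  The first quantifier says that the vertical line has not turned to a lower input before
  it reaches the level of \<open>d\<close>, the second one that the horizontal line, which comes from the
  left, gets as far as \<open>x\<close>.  Both are strict, so connected letters do not cross each other.
\<close>

definition cross_pairs :: "(letter \<times> 's) set \<Rightarrow> ('s \<times> 's) set \<Rightarrow> ('s \<times> 's) set" where
  "cross_pairs S M = {(x, d). (LX, x) \<in> S \<and> (LD, d) \<in> S \<and> prec (LD, d) (LX, x)
     \<and> (\<forall>d'. (x, d') \<in> M \<longrightarrow> prec (LD, d') (LD, d))
     \<and> (\<forall>x'. (x', d) \<in> M \<longrightarrow> prec (LX, x) (LX, x'))}"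

definition matching_term ::
    "nat \<Rightarrow> nat \<Rightarrow> (letter \<times> 's) set \<Rightarrow> ('s \<times> 's) set \<Rightarrow> 'a::comm_ring_1 poly" where
  "matching_term a b S M = (if card (free LX S (fst ` M)) = a \<and> card (free LD S (snd ` M)) = b
     then qvar ^ card (cross_pairs S M) else 0)"

lemma prec_irrefl: "\<not> prec p p"
  using prec_asym by blast

lemma finite_free: "finite S \<Longrightarrow> finite (free c S T)"
  unfolding free_def
  by (rule finite_Diff, rule finite_subset[of _ "snd ` S"]) force+

lemma matchings_subset: "M \<in> matchings S \<Longrightarrow> M \<subseteq> snd ` S \<times> snd ` S"
  unfolding matchings_def by force

lemma finite_matchings: "finite S \<Longrightarrow> finite (matchings S)"
  by (rule finite_subset[of _ "Pow (snd ` S \<times> snd ` S)"])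
    (use matchings_subset in blast, simp)

lemma finite_cross_pairs: "finite S \<Longrightarrow> finite (cross_pairs S M)"
  by (rule finite_subset[of _ "snd ` S \<times> snd ` S"]) (force simp: cross_pairs_def)+

text \<open>
  Since \<open>prec\<close> is a linear order, counting predecessors numbers \<open>F\<close> by
  \<open>0, \<dots>, card F - 1\<close>.  For \<open>g i = q\<^sup>i\<close> this produces the \<open>q\<close>-integer of
  \<open>card F\<close>.
\<close>

lemma sum_over_ranks:
  assumes "finite F"
  shows "(\<Sum>x\<in>F. g (card {y \<in> F. prec (c, y) (c, x)})) = (\<Sum>i<card F. g i)"
proof -
  define rank where "rank x = card {y \<in> F. prec (c, y) (c, x)}" for x
  have mono: "rank x < rank y" if "x \<in> F" "prec (c, x) (c, y)" for x y
    unfolding rank_def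
    by (rule psubset_card_mono)
      (use assms in simp, use that prec_irrefl in \<open>blast intro: prec_trans\<close>)
  have inj: "inj_on rank F"
  proof (rule inj_onI, rule ccontr)
    fix x y assume "x \<in> F" "y \<in> F" "rank x = rank y" "x \<noteq> y"
    then show False using mono[of x y] mono[of y x] prec_total[of "(c, x)" "(c, y)"] by auto
  qed
  have "rank x < card F" if "x \<in> F" for x
    unfolding rank_def
    by (rule psubset_card_mono) (use assms that prec_irrefl in auto)
  then have "rank ` F = {..<card F}"
    by (intro card_subset_eq) (auto simp: card_image[OF inj])
  then show ?thesis
    using sum.reindex[OF inj, of g] unfolding rank_def by simp
qed

text \<open>
  A letter \<open>X\<close> in front of a word has no \<open>\<Delta>\<close> to its left: it stays unmatched, its
  vertical line meets nothing, and only the number of outputs changes.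
\<close>

lemma matchings_insert_LX:
  assumes "\<forall>p\<in>S. prec (LX, x) p"
  shows "matchings (insert (LX, x) S) = matchings S"
  unfolding matchings_def using assms prec_asym by (fastforce simp: case_prod_beta)

lemma matching_term_insert_LX:
  assumes first: "\<forall>p\<in>S. prec (LX, x) p" and "finite S" and M: "M \<in> matchings S"
  shows "matching_term a b (insert (LX, x) S) M
    = (if a = 0 then 0 else matching_term (a - 1) b S M)"
proof -
  have x: "(LX, x) \<notin> S" using first prec_irrefl by blast
  then have "x \<notin> fst ` M" using M unfolding matchings_def by auto
  then have "free LX (insert (LX, x) S) (fst ` M) = insert x (free LX S (fst ` M))"
    unfolding free_def by auto
  moreover have "x \<notin> free LX S (fst ` M)" using x unfolding free_def by auto
  ultimately have "card (free LX (insert (LX, x) S) (fst ` M)) = Suc (card (free LX S (fst ` M)))"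
    using finite_free[OF \<open>finite S\<close>] by simp
  moreover have "free LD (insert (LX, x) S) (snd ` M) = free LD S (snd ` M)"
    unfolding free_def by auto
  moreover have "cross_pairs (insert (LX, x) S) M = cross_pairs S M"
    unfolding cross_pairs_def using first prec_asym by blast
  ultimately show ?thesis unfolding matching_term_def by (cases a) auto
qed

text \<open>
  A letter \<open>\<Delta>\<close> in front of a word is either unmatched or matched with one of the free letters
  \<open>X\<close>; each matching of the longer word arises in exactly one way.
\<close>

lemma matchings_insert_LD:
  assumes first: "\<forall>p\<in>S. prec (LD, d) p"
  shows "matchings (insert (LD, d) S) = matchings S \<union>
    (\<lambda>(M, x). insert (x, d) M) ` (SIGMA M:matchings S. free LX S (fst ` M))" (is "?L = ?A \<union> ?B")
proof (intro subset_antisym subsetI)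
  fix M assume M: "M \<in> ?L"
  show "M \<in> ?A \<union> ?B"
  proof (cases "d \<in> snd ` M")
    case False
    then have "\<forall>p\<in>M. snd p \<noteq> d" by blast
    then have "M \<in> ?A" using M unfolding matchings_def case_prod_beta by auto
    then show ?thesis ..
  next
    case True
    then obtain x where x: "(x, d) \<in> M" by auto
    have inj: "inj_on fst M" "inj_on snd M" using M unfolding matchings_def by auto
    have dd: "d' \<noteq> d" if "(y, d') \<in> M - {(x, d)}" for y d'
      using that x inj_onD[OF inj(2), of "(y, d')" "(x, d)"] by auto
    have xx: "y \<noteq> x" if "(y, d') \<in> M - {(x, d)}" for y d'
      using that x inj_onD[OF inj(1), of "(y, d')" "(x, d)"] by auto
    have "M - {(x, d)} \<in> matchings S"
      unfolding matchings_def
    proof (intro CollectI conjI ballI)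
      fix p assume "p \<in> M - {(x, d)}"
      then show "case p of (x, d) \<Rightarrow> (LX, x) \<in> S \<and> (LD, d) \<in> S \<and> prec (LD, d) (LX, x)"
        using M dd[of "fst p" "snd p"] unfolding matchings_def by auto
    qed (use inj in \<open>auto intro: inj_on_diff\<close>)
    moreover have "x \<notin> fst ` (M - {(x, d)})"
    proof
      assume "x \<in> fst ` (M - {(x, d)})"
      then obtain p where "p \<in> M - {(x, d)}" "x = fst p" by blast
      then show False using xx[of "fst p" "snd p"] by simp
    qed
    then have "x \<in> free LX S (fst ` (M - {(x, d)}))"
      using x M unfolding matchings_def free_def by auto
    moreover have "M = insert (x, d) (M - {(x, d)})" using x by auto
    ultimately have "M \<in> ?B"
      by (intro image_eqI[of _ _ "(M - {(x, d)}, x)"]) auto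
    then show ?thesis ..
  qed
next
  have d: "(LD, d) \<notin> S" using first prec_irrefl by blast
  fix M assume "M \<in> ?A \<union> ?B"
  then show "M \<in> ?L"
  proof
    assume "M \<in> ?B"
    then obtain M' x where M': "M = insert (x, d) M'" "M' \<in> matchings S"
      "x \<in> free LX S (fst ` M')" by auto
    have "x \<notin> fst ` M'" "(LX, x) \<in> S" using M'(3) unfolding free_def by auto
    moreover have "d \<notin> snd ` M'" using M'(2) d unfolding matchings_def by auto
    moreover have "prec (LD, d) (LX, x)" using first \<open>(LX, x) \<in> S\<close> by blast
    ultimately show ?thesis using M'(1,2) unfolding matchings_def by auto
  qed (auto simp: matchings_def)
qed

lemma sum_matchings_insert_LD:
  assumes first: "\<forall>p\<in>S. prec (LD, d) p" and fin: "finite S"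
  shows "(\<Sum>M\<in>matchings (insert (LD, d) S). f M) =
    (\<Sum>M\<in>matchings S. f M + (\<Sum>x\<in>free LX S (fst ` M). f (insert (x, d) M)))"
proof -
  let ?P = "SIGMA M:matchings S. free LX S (fst ` M)" and ?h = "\<lambda>(M, x). insert (x, d) M"
  have "(LD, d) \<notin> S" using first prec_irrefl by blast
  then have d: "d \<notin> snd ` M" if "M \<in> matchings S" for M
    using that unfolding matchings_def by auto
  have inj: "inj_on ?h ?P"
  proof (rule inj_onI, clarify)
    fix M x M' x'
    assume "M \<in> matchings S" "M' \<in> matchings S" and eq: "insert (x, d) M = insert (x', d) M'"
    then have "(y, d) \<notin> M" "(y, d) \<notin> M'" for y using d by force+
    then have "(x, d) = (x', d)" using eq by blast
    moreover from this have "M = M'"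
      using eq \<open>\<And>y. (y, d) \<notin> M\<close> \<open>\<And>y. (y, d) \<notin> M'\<close> by (simp add: insert_ident)
    ultimately show "M = M' \<and> x = x'" by simp
  qed
  have disj: "matchings S \<inter> ?h ` ?P = {}" using d by force
  have "(\<Sum>M\<in>matchings (insert (LD, d) S). f M)
      = (\<Sum>M\<in>matchings S. f M) + (\<Sum>M\<in>?h ` ?P. f M)"
    unfolding matchings_insert_LD[OF first]
    by (rule sum.union_disjoint)
      (use disj fin in \<open>auto intro!: finite_imageI finite_SigmaI finite_matchings finite_free\<close>)
  also have "(\<Sum>M\<in>?h ` ?P. f M) = (\<Sum>(M, x)\<in>?P. f (insert (x, d) M))"
    by (subst sum.reindex[OF inj]) (auto intro!: sum.cong)
  also have "\<dots> = (\<Sum>M\<in>matchings S. \<Sum>x\<in>free LX S (fst ` M). f (insert (x, d) M))"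
    by (rule sum.Sigma[symmetric]) (use fin in \<open>auto intro: finite_matchings finite_free\<close>)
  finally show ?thesis by (simp add: sum.distrib)
qed

text \<open>
  An unmatched new input is a half-line above all older inputs, so it crosses exactly the
  vertical lines that are still free.  This is the summand \<open>q\<^sup>a X\<^sup>a \<Delta>\<close> of
  \<open>\<Delta>X\<^sup>a\<close>.
\<close>

lemma matching_term_insert_LD_free:
  assumes first: "\<forall>p\<in>S. prec (LD, d) p" and fin: "finite S" and M: "M \<in> matchings S"
  shows "matching_term a b (insert (LD, d) S) M
    = qvar ^ a * (if b = 0 then 0 else matching_term a (b - 1) S M)"
proof -
  have d: "(LD, d) \<notin> S" using first prec_irrefl by blast
  have dM: "(y, d) \<notin> M" for y using M d unfolding matchings_def by auto
  have d': "prec (LD, d) (LD, d')" if "(y, d') \<in> M" for y d'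
    using M first that unfolding matchings_def by blast
  have "free LD (insert (LD, d) S) (snd ` M) = insert d (free LD S (snd ` M))"
    using dM unfolding free_def by auto
  moreover have "d \<notin> free LD S (snd ` M)" using d unfolding free_def by auto
  ultimately have D: "card (free LD (insert (LD, d) S) (snd ` M)) = Suc (card (free LD S (snd ` M)))"
    using finite_free[OF fin] by simp
  have X: "free LX (insert (LD, d) S) (fst ` M) = free LX S (fst ` M)"
    unfolding free_def by auto
  have "cross_pairs (insert (LD, d) S) M = cross_pairs S M \<union> (\<lambda>x. (x, d)) ` free LX S (fst ` M)"
    unfolding cross_pairs_def free_def using first dM d' prec_asym by (fastforce simp: image_iff)
  moreover have "cross_pairs S M \<inter> (\<lambda>x. (x, d)) ` free LX S (fst ` M) = {}"
    unfolding cross_pairs_def using d by auto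
  ultimately have "card (cross_pairs (insert (LD, d) S) M)
      = card (cross_pairs S M) + card (free LX S (fst ` M))"
    using finite_cross_pairs[OF fin] finite_free[OF fin]
    by (simp add: card_Un_disjoint card_image inj_on_def)
  with D X show ?thesis unfolding matching_term_def
    by (cases b) (auto simp: power_add mult.commute)
qed

text \<open>
  A new input connected to \<open>x\<close> crosses exactly the free vertical lines to the left of \<open>x\<close>.
  The older crossings survive, also those on the vertical line of \<open>x\<close>: it now turns, but only
  above all older horizontal lines.
\<close>

lemma matching_term_insert_LD_matched:
  assumes first: "\<forall>p\<in>S. prec (LD, d) p" and fin: "finite S" and M: "M \<in> matchings S"
    and x: "x \<in> free LX S (fst ` M)"
  shows "matching_term a b (insert (LD, d) S) (insert (x, d) M) =
    qvar ^ card {y \<in> free LX S (fst ` M). prec (LX, y) (LX, x)} * matching_term (Suc a) b S M"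
proof -
  let ?F = "free LX S (fst ` M)"
  have d: "(LD, d) \<notin> S" using first prec_irrefl by blast
  have dM: "(y, d) \<notin> M" for y using M d unfolding matchings_def by auto
  have d': "prec (LD, d) (LD, d')" if "(y, d') \<in> M" for y d'
    using M first that unfolding matchings_def by blast
  have xS: "(LX, x) \<in> S" and xM: "(x, d') \<notin> M" for d'
    using x unfolding free_def by force+
  have D: "free LD (insert (LD, d) S) (snd ` insert (x, d) M) = free LD S (snd ` M)"
    using d unfolding free_def by auto
  have "free LX (insert (LD, d) S) (fst ` insert (x, d) M) = ?F - {x}"
    unfolding free_def by auto
  then have X: "card (free LX (insert (LD, d) S) (fst ` insert (x, d) M)) = a \<longleftrightarrow> card ?F = Suc a"
    using x finite_free[OF fin] by (metis card_Suc_Diff1 nat.inject)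
  have "cross_pairs (insert (LD, d) S) (insert (x, d) M)
      = cross_pairs S M \<union> (\<lambda>y. (y, d)) ` {y \<in> ?F. prec (LX, y) (LX, x)}" (is "?L = ?R")
  proof (rule set_eqI, clarify)
    fix y e
    show "(y, e) \<in> ?L \<longleftrightarrow> (y, e) \<in> ?R"
    proof (cases "e = d")
      case True
      have "(y, d) \<in> ?L \<longleftrightarrow> (LX, y) \<in> S \<and> prec (LX, y) (LX, x) \<and> (\<forall>d'. (y, d') \<notin> M)"
        unfolding cross_pairs_def using first dM d' prec_asym prec_irrefl by auto
      also have "\<dots> \<longleftrightarrow> (y, d) \<in> ?R"
        unfolding cross_pairs_def free_def using d by (force simp: image_iff)
      finally show ?thesis using True by simp
    next
      case False
      then show ?thesis unfolding cross_pairs_def using first xM by auto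
    qed
  qed
  moreover have "cross_pairs S M \<inter> (\<lambda>y. (y, d)) ` {y \<in> ?F. prec (LX, y) (LX, x)} = {}"
    unfolding cross_pairs_def using d by auto
  ultimately have "card (cross_pairs (insert (LD, d) S) (insert (x, d) M))
      = card (cross_pairs S M) + card {y \<in> ?F. prec (LX, y) (LX, x)}"
    using finite_cross_pairs[OF fin] finite_free[OF fin]
    by (simp add: card_Un_disjoint card_image inj_on_def)
  with D X show ?thesis unfolding matching_term_def
    by (auto simp: power_add mult.commute)
qed

text \<open>
  Both sides satisfy the same recursion in the leftmost letter.  For \<open>\<Delta>\<close>, summing over the
  free \<open>X\<close> that is matched turns the powers of \<open>q\<close> into the \<open>q\<close>-integer.
\<close>

theorem word_coeff_eq_sum_matchings:
  assumes "sorted_wrt prec L"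
  shows "(word_coeff (map fst L) a b :: 'a::comm_ring_1 poly) = (\<Sum>M\<in>matchings (set L). matching_term a b (set L) M)"
  using assms
proof (induction L arbitrary: a b)
  case Nil
  have "matchings {} = {{}}" unfolding matchings_def by auto
  then show ?case by (auto simp: matching_term_def free_def cross_pairs_def)
next
  case (Cons p L)
  let ?S = "set L"
  obtain c x where p: "p = (c, x)" by (cases p)
  have first: "\<forall>p'\<in>?S. prec (c, x) p'" and sorted: "sorted_wrt prec L"
    using Cons.prems p by auto
  note IH = Cons.IH[OF sorted]
  show ?case
  proof (cases c)
    case LX
    have "(\<Sum>M\<in>matchings (insert (LX, x) ?S). matching_term a b (insert (LX, x) ?S) M :: 'a poly)
        = (\<Sum>M\<in>matchings ?S. if a = 0 then 0 else matching_term (a - 1) b ?S M)"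
      using first LX
      by (simp add: matchings_insert_LX matching_term_insert_LX cong: sum.cong)
    then show ?thesis by (cases "a = 0") (simp_all add: IH p LX)
  next
    case LD
    have first': "\<forall>p'\<in>?S. prec (LD, x) p'" using first LD by simp
    have "(\<Sum>M\<in>matchings (insert (LD, x) ?S). matching_term a b (insert (LD, x) ?S) M :: 'a poly)
        = (\<Sum>M\<in>matchings ?S. qvar ^ a * (if b = 0 then 0 else matching_term a (b - 1) ?S M)
            + (\<Sum>i<Suc a. qvar ^ i) * matching_term (Suc a) b ?S M)"
      unfolding sum_matchings_insert_LD[OF first' finite_set]
    proof (rule sum.cong[OF refl])
      fix M assume M: "M \<in> matchings ?S"
      let ?F = "free LX ?S (fst ` M)"
      have "(\<Sum>y\<in>?F. matching_term a b (insert (LD, x) ?S) (insert (y, x) M) :: 'a poly)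
          = (\<Sum>y\<in>?F. qvar ^ card {z \<in> ?F. prec (LX, z) (LX, y)}) * matching_term (Suc a) b ?S M"
        by (simp add: matching_term_insert_LD_matched[OF first' finite_set M] sum_distrib_right)
      also have "\<dots> = (\<Sum>i<card ?F. qvar ^ i) * matching_term (Suc a) b ?S M"
        by (simp only: sum_over_ranks[OF finite_free[OF finite_set], of "\<lambda>i. qvar ^ i"])
      \<comment> \<open>the factor \<open>matching_term (Suc a) b ?S M\<close> vanishes unless \<open>card ?F = Suc a\<close>\<close>
      also have "\<dots> = (\<Sum>i<Suc a. qvar ^ i) * matching_term (Suc a) b ?S M"
        unfolding matching_term_def by (auto simp del: sum.lessThan_Suc)
      finally show "(matching_term a b (insert (LD, x) ?S) M :: 'a poly)
            + (\<Sum>y\<in>?F. matching_term a b (insert (LD, x) ?S) (insert (y, x) M))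
          = qvar ^ a * (if b = 0 then 0 else matching_term a (b - 1) ?S M)
            + (\<Sum>i<Suc a. qvar ^ i) * matching_term (Suc a) b ?S M"
        by (simp only: matching_term_insert_LD_free[OF first' finite_set M])
    qed
    also have "\<dots> = word_coeff (LD # map fst L) a b"
      by (cases b) (simp_all add: IH sum.distrib sum_distrib_left del: sum.lessThan_Suc)
    finally show ?thesis using p LD by simp
  qed
qed

end


section \<open>Powers of a polynomial in normal form\<close>

lemma inv_coeff_sum: "inv_coeff a b (\<Sum>i\<in>I. f i) = (\<Sum>i\<in>I. inv_coeff a b (f i))"
proof (induction I rule: infinite_finite_induct)
  case (insert x F)
  then show ?case by (simp add: inv_coeff_add)
qed (simp_all add: inv_coeff_def)

lemma op_poly_eq_sum_singles:
  "p = (\<Sum>u\<in>Poly_Mapping.keys p. Poly_Mapping.single u (Poly_Mapping.lookup p u))"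
  by (rule poly_mapping_eqI) (auto simp: lookup_sum lookup_single when_def in_keys_iff)

text \<open>
  A step changes \<open>p\<close> by a multiple of \<open>u(1 + qX\<Delta> - \<Delta>X)v\<close>, and multiplying by words on
  both sides leads to a multiple of the same shape, on which the coefficient functional vanishes.
  So the functional vanishes on the two-sided ideal generated by the relation, and normalising
  may be done inside products.
\<close>

lemma inv_coeff_step_mult:
  assumes "rewrite_step p p'"
  shows "inv_coeff a b (f * p * g) = inv_coeff a b (f * p' * g)"
  using assms
proof cases
  case (1 c u v)
  define t where "t = Poly_Mapping.single (u + v) c
    + Poly_Mapping.single (u + Word [LX, LD] + v) (c * qvar)
    - Poly_Mapping.single (u + Word [LD, LX] + v) c"
  have p': "p' = p + t" using 1 unfolding t_def by simp
  have single: "inv_coeff a b (Poly_Mapping.single x k * t * Poly_Mapping.single y l) = 0" for x y k l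
    unfolding t_def
    by (simp add: algebra_simps mult_single inv_coeff_add inv_coeff_diff inv_coeff_single
        plus_op_word_def)
      (simp add: word_coeff_rewrite[of "letters x @ letters u" "letters v @ letters y", simplified]
        algebra_simps)
  have "inv_coeff a b (f * t * g) = 0"
    by (subst op_poly_eq_sum_singles[of f], subst op_poly_eq_sum_singles[of g])
      (simp only: sum_distrib_left sum_distrib_right inv_coeff_sum single sum.neutral_const)
  then show ?thesis by (simp add: p' algebra_simps inv_coeff_add)
qed

lemma inv_coeff_steps_mult:
  "rewrite_step\<^sup>*\<^sup>* p p' \<Longrightarrow> inv_coeff a b (f * p * g) = inv_coeff a b (f * p' * g)"
  by (induction rule: rtranclp_induct) (simp_all add: inv_coeff_step_mult)

text \<open>
  The factors of \<open>h\<^sup>n\<close> are normalised one at a time, from left to right.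
\<close>

lemma inv_coeff_normal_form_power: "inv_coeff a b (h ^ n) = inv_coeff a b (normal_form h ^ n)"
proof -
  have "inv_coeff a b (normal_form h ^ k * h ^ m) = inv_coeff a b (normal_form h ^ (k + m))" for k m
  proof (induction m arbitrary: k)
    case (Suc m)
    have "inv_coeff a b (normal_form h ^ k * h * h ^ m)
        = inv_coeff a b (normal_form h ^ Suc k * h ^ m)"
      using inv_coeff_steps_mult[OF normal_form_steps, of a b "normal_form h ^ k" h "h ^ m"]
      by (simp add: power_commutes)
    then show ?case using Suc.IH[of "Suc k"] by (simp add: mult.assoc)
  qed simp
  from this[of 0 n] show ?thesis by simp
qed

lemma sum_PiE_atLeastAtMost_Suc:
  "(\<Sum>\<gamma>\<in>{1..Suc n} \<rightarrow>\<^sub>E H. f \<gamma>) = (\<Sum>t\<in>H. \<Sum>\<gamma>\<in>{1..n} \<rightarrow>\<^sub>E H. f (\<gamma>(Suc n := t)))"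
proof -
  have I: "{1..Suc n} = insert (Suc n) {1..n}" by auto
  have "(\<Sum>\<gamma>\<in>{1..Suc n} \<rightarrow>\<^sub>E H. f \<gamma>)
      = (\<Sum>y\<in>H \<times> ({1..n} \<rightarrow>\<^sub>E H). f ((\<lambda>(t, \<gamma>). \<gamma>(Suc n := t)) y))"
    unfolding I PiE_insert_eq
    by (subst sum.reindex) (auto intro: inj_combinator)
  then show ?thesis by (simp add: sum.cartesian_product case_prod_beta)
qed

text \<open>
  The gate with the largest label comes first, being the leftmost factor of the product.  Its
  inputs are listed in descending order, since the lowest one is the first application of
  \<open>\<Delta>\<close> and thus the rightmost letter.
\<close>

fun slot_list :: "(nat \<Rightarrow> nat \<times> nat) \<Rightarrow> nat \<Rightarrow> (letter \<times> slot) list" where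
  "slot_list \<gamma> 0 = []"
| "slot_list \<gamma> (Suc n) = map (\<lambda>k. (LX, (Suc n, k))) [1..<Suc (fst (\<gamma> (Suc n)))]
     @ map (\<lambda>l. (LD, (Suc n, l))) (rev [1..<Suc (snd (\<gamma> (Suc n)))]) @ slot_list \<gamma> n"

lemma slot_list_cong: "(\<And>j. j \<in> {1..n} \<Longrightarrow> \<gamma> j = \<gamma>' j) \<Longrightarrow> slot_list \<gamma> n = slot_list \<gamma>' n"
  by (induction n) auto

text \<open>
  Distributivity: the types \<open>\<gamma>\<close> of the gates \<open>1, \<dots>, n\<close> record which summand is chosen
  in each of the \<open>n\<close> factors.
\<close>

lemma power_sum_normal_words:
  fixes w :: "nat \<times> nat \<Rightarrow> 'a::comm_ring_1"
  shows "(\<Sum>(r, s)\<in>H. Poly_Mapping.single (normal_word r s) [:w (r, s):]) ^ n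
    = (\<Sum>\<gamma>\<in>{1..n} \<rightarrow>\<^sub>E H.
        Poly_Mapping.single (Word (map fst (slot_list \<gamma> n))) [:\<Prod>j\<in>{1..n}. w (\<gamma> j):])"
proof (induction n)
  case 0
  show ?case by (simp add: zero_op_word_def[symmetric] one_pCons[symmetric])
next
  case (Suc n)
  have upd: "slot_list (\<gamma>(Suc n := t)) n = slot_list \<gamma> n"
      "(\<Prod>j\<in>{1..n}. w ((\<gamma>(Suc n := t)) j)) = (\<Prod>j\<in>{1..n}. w (\<gamma> j))" for \<gamma> t
    by (rule slot_list_cong, simp) (rule prod.cong, auto)
  have "Poly_Mapping.single (normal_word (fst t) (snd t)) [:w t:]
      * Poly_Mapping.single (Word (map fst (slot_list \<gamma> n))) [:\<Prod>j\<in>{1..n}. w (\<gamma> j):]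
    = Poly_Mapping.single (Word (map fst (slot_list (\<gamma>(Suc n := t)) (Suc n))))
        [:\<Prod>j\<in>{1..Suc n}. w ((\<gamma>(Suc n := t)) j):]" for \<gamma> t
  proof -
    have "map fst (slot_list (\<gamma>(Suc n := t)) (Suc n))
        = replicate (fst t) LX @ replicate (snd t) LD @ map fst (slot_list \<gamma> n)"
      by (simp add: upd comp_def map_replicate_const del: upt_Suc)
    moreover have "(\<Prod>j\<in>{1..Suc n}. w ((\<gamma>(Suc n := t)) j)) = w t * (\<Prod>j\<in>{1..n}. w (\<gamma> j))"
      by (simp add: prod.nat_ivl_Suc' upd)
    ultimately show ?thesis
      by (simp add: mult_single normal_word_def plus_op_word_def)
  qed
  then show ?case
    unfolding power_Suc Suc.IH sum_PiE_atLeastAtMost_Suc sum_product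
    by (simp only: case_prod_beta prod.collapse)
qed


section \<open>The slots of a diagram as letters of a word\<close>

fun left_of :: "slot \<Rightarrow> slot \<Rightarrow> bool"
  where "left_of (i, k) (i', k') \<longleftrightarrow> i' < i \<or> i = i' \<and> k < k'"

fun above :: "slot \<Rightarrow> slot \<Rightarrow> bool"
  where "above (j, l) (j', l') \<longleftrightarrow> j' < j \<or> j = j' \<and> l' < l"

text \<open>
  The order of the letters in \<open>slot_list\<close>.  Within one gate the outputs come before the inputs,
  as in \<open>X\<^sup>r\<Delta>\<^sup>s\<close>; therefore the comparison of labels is strict in the last clause only, and
  an output is never connected to an input of the same gate.
\<close>

fun precedes :: "letter \<times> slot \<Rightarrow> letter \<times> slot \<Rightarrow> bool" where
  "precedes (LX, x) (LX, x') = left_of x x'"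
| "precedes (LD, d) (LD, d') = above d d'"
| "precedes (LX, x) (LD, d) = (fst d \<le> fst x)"
| "precedes (LD, d) (LX, x) = (fst x < fst d)"

interpretation slots: slot_order precedes
proof
  fix p p' p'' :: "letter \<times> slot"
  obtain c i k c' i' k' c'' i'' k'' where
    p: "p = (c, i, k)" "p' = (c', i', k')" "p'' = (c'', i'', k'')"
    by (metis prod_cases3)
  show "precedes p p' \<Longrightarrow> \<not> precedes p' p"
    unfolding p by (cases c; cases c') auto
  show "precedes p p' \<Longrightarrow> precedes p' p'' \<Longrightarrow> precedes p p''"
    unfolding p by (cases c; cases c'; cases c'') auto
  show "p \<noteq> p' \<Longrightarrow> precedes p p' \<or> precedes p' p"
    unfolding p by (cases c; cases c') auto
qed

lemma set_slot_list:
  "set (slot_list \<gamma> n) = Pair LX ` (SIGMA j:{1..n}. {1..fst (\<gamma> j)})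
     \<union> Pair LD ` (SIGMA j:{1..n}. {1..snd (\<gamma> j)})"
proof (induction n)
  case (Suc n)
  have S: "{1..Suc n} = insert (Suc n) {1..n}" by auto
  show ?case unfolding slot_list.simps set_append Suc.IH S by (force simp del: upt_Suc)
qed simp

lemma mem_slot_list [simp]:
  "(LX, x) \<in> set (slot_list (gate_type \<delta>) n) \<longleftrightarrow> x \<in> out_slots n \<delta>"
  "(LD, x) \<in> set (slot_list (gate_type \<delta>) n) \<longleftrightarrow> x \<in> in_slots n \<delta>"
  unfolding set_slot_list out_slots_def in_slots_def by auto

lemma sorted_slot_list: "sorted_wrt precedes (slot_list \<gamma> n)"
proof (induction n)
  case (Suc n)
  have "sorted_wrt (\<lambda>k k'. precedes (LX, (Suc n, k)) (LX, (Suc n, k'))) [1..<m]" for m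
    by (simp add: sorted_wrt_upt del: upt_Suc)
  moreover have "sorted_wrt (\<lambda>k k'. precedes (LD, (Suc n, k)) (LD, (Suc n, k'))) (rev [1..<m])" for m
    by (simp add: sorted_wrt_rev sorted_wrt_upt del: upt_Suc)
  moreover have "precedes (c, (Suc n, k)) p" if "p \<in> set (slot_list \<gamma> n)" for c k p
    using that unfolding set_slot_list by (cases c) auto
  ultimately show ?case using Suc.IH
    by (auto simp: sorted_wrt_append sorted_wrt_map simp del: upt_Suc)
qed simp


text \<open>
  The condition \<open>i < j\<close> on a connection is \<open>precedes (LD, d) (LX, x)\<close> verbatim, so the sets
  of connections for given gate types are the matchings of the word of these types.
\<close>

lemma labelled_diagrams_eq_Sigma:
  "labelled_diagrams \<H> n
    = (SIGMA \<gamma>:{1..n} \<rightarrow>\<^sub>E \<H>. slots.matchings (set (slot_list \<gamma> n)))"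
proof -
  have "(\<gamma>, C) \<in> labelled_diagrams \<H> n
      \<longleftrightarrow> \<gamma> \<in> {1..n} \<rightarrow>\<^sub>E \<H> \<and> C \<in> slots.matchings (set (slot_list \<gamma> n))" for \<gamma> C
    using mem_slot_list[of _ "(\<gamma>, C)"]
    unfolding labelled_diagrams_def slots.matchings_def by (fastforce simp: subset_iff)
  then show ?thesis by auto
qed


section \<open>Crossings of an embedded diagram\<close>

lemma gate_right_antimono: "i \<le> j \<Longrightarrow> gate_right \<delta> j \<le> gate_right \<delta> i"
  unfolding gate_right_def by (simp, rule sum_mono2) auto

lemma gate_bottom_mono: "i \<le> j \<Longrightarrow> gate_bottom \<delta> i \<le> gate_bottom \<delta> j"
  unfolding gate_bottom_def by (rule sum_mono2) auto

lemma gate_right_Suc: "1 \<le> j \<Longrightarrow> gate_right \<delta> (Suc j) = gate_left \<delta> j"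
  unfolding gate_right_def gate_left_def by simp

lemma gate_bottom_Suc: "1 \<le> j \<Longrightarrow> gate_bottom \<delta> (Suc j) = gate_top \<delta> j"
  unfolding gate_bottom_def gate_top_def by simp

lemma out_x_bounds:
  assumes "x \<in> out_slots n \<delta>"
  shows "gate_left \<delta> (fst x) < out_x \<delta> x" "out_x \<delta> x < gate_right \<delta> (fst x)"
  using assms unfolding out_slots_def out_x_def gate_left_def by auto

lemma in_y_bounds:
  assumes "d \<in> in_slots n \<delta>"
  shows "gate_bottom \<delta> (fst d) < in_y \<delta> d" "in_y \<delta> d < gate_top \<delta> (fst d)"
  using assms unfolding in_slots_def in_y_def gate_top_def by auto

text \<open>
  The boxes of the gates project to intervals of the x-axis that follow each other from right to
  left, and to intervals of the y-axis that follow each other upwards; the lines of a gate run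
  strictly inside its intervals.  Hence comparisons of the real coordinates that occur in
  crossings reduce to comparisons of labels and slot numbers.
\<close>

lemma gate_right_le_out_x_iff:
  assumes "x \<in> out_slots n \<delta>"
  shows "gate_right \<delta> j \<le> out_x \<delta> x \<longleftrightarrow> fst x < j"
proof
  assume "fst x < j"
  moreover have "1 \<le> fst x" using assms unfolding out_slots_def by auto
  ultimately have "gate_right \<delta> j \<le> gate_left \<delta> (fst x)"
    using gate_right_antimono[of "Suc (fst x)" j \<delta>] by (simp add: gate_right_Suc)
  then show "gate_right \<delta> j \<le> out_x \<delta> x" using out_x_bounds[OF assms] by linarith
next
  assume "gate_right \<delta> j \<le> out_x \<delta> x"
  then show "fst x < j"
    using gate_right_antimono[of j "fst x" \<delta>] out_x_bounds[OF assms] by linarith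
qed

lemma gate_top_le_in_y_iff:
  assumes "d \<in> in_slots n \<delta>" "1 \<le> i"
  shows "gate_top \<delta> i \<le> in_y \<delta> d \<longleftrightarrow> i < fst d"
proof
  assume "i < fst d"
  then have "gate_top \<delta> i \<le> gate_bottom \<delta> (fst d)"
    using gate_bottom_mono[of "Suc i" "fst d" \<delta>] assms(2) by (simp add: gate_bottom_Suc)
  then show "gate_top \<delta> i \<le> in_y \<delta> d" using in_y_bounds[OF assms(1)] by linarith
next
  assume "gate_top \<delta> i \<le> in_y \<delta> d"
  then show "i < fst d"
    using gate_bottom_mono[of "Suc (fst d)" "Suc i" \<delta>] gate_bottom_Suc[of "fst d" \<delta>]
      gate_bottom_Suc[OF assms(2), of \<delta>] in_y_bounds[OF assms(1)] assms(1)
    unfolding in_slots_def by force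
qed

lemma out_x_less:
  assumes "x \<in> out_slots n \<delta>" "x' \<in> out_slots n \<delta>" "left_of x x'"
  shows "out_x \<delta> x < out_x \<delta> x'"
proof (cases "fst x = fst x'")
  case True
  then show ?thesis using assms(3) unfolding out_x_def by (cases x; cases x') auto
next
  case False
  then have "fst x' < fst x" using assms(3) by (cases x; cases x') auto
  then have "gate_right \<delta> (fst x) \<le> out_x \<delta> x'"
    using gate_right_le_out_x_iff[OF assms(2)] by blast
  then show ?thesis using out_x_bounds[OF assms(1)] by linarith
qed

lemma in_y_less:
  assumes "d \<in> in_slots n \<delta>" "d' \<in> in_slots n \<delta>" "above d' d"
  shows "in_y \<delta> d < in_y \<delta> d'"
proof (cases "fst d = fst d'")
  case True
  then show ?thesis using assms(3) unfolding in_y_def by (cases d; cases d') auto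
next
  case False
  then have "fst d < fst d'" using assms(3) by (cases d; cases d') auto
  moreover have "1 \<le> fst d" using assms(1) unfolding in_slots_def by auto
  ultimately have "gate_top \<delta> (fst d) \<le> in_y \<delta> d'"
    using gate_top_le_in_y_iff[OF assms(2)] by blast
  then show ?thesis using in_y_bounds[OF assms(1)] by linarith
qed

lemma out_x_le_iff:
  assumes "x \<in> out_slots n \<delta>" "x' \<in> out_slots n \<delta>" "x \<noteq> x'"
  shows "out_x \<delta> x \<le> out_x \<delta> x' \<longleftrightarrow> left_of x x'"
proof -
  have "left_of x x' \<or> left_of x' x" using slots.prec_total[of "(LX, x)" "(LX, x')"] assms(3) by auto
  then show ?thesis using out_x_less[of x n \<delta> x'] out_x_less[of x' n \<delta> x] assms by auto
qed

lemma in_y_le_iff: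
  assumes "d \<in> in_slots n \<delta>" "d' \<in> in_slots n \<delta>" "d \<noteq> d'"
  shows "in_y \<delta> d \<le> in_y \<delta> d' \<longleftrightarrow> above d' d"
proof -
  have "above d d' \<or> above d' d" using slots.prec_total[of "(LD, d)" "(LD, d')"] assms(3) by auto
  then show ?thesis using in_y_less[of d n \<delta> d'] in_y_less[of d' n \<delta> d] assms by auto
qed

lemma inj_on_out_x: "inj_on (out_x \<delta>) (out_slots n \<delta>)"
  by (rule inj_onI) (metis out_x_le_iff order_refl slots.prec_asym precedes.simps(1))

lemma inj_on_in_y: "inj_on (in_y \<delta>) (in_slots n \<delta>)"
  by (rule inj_onI) (metis in_y_le_iff order_refl slots.prec_asym precedes.simps(2))

fun source :: "edge \<Rightarrow> slot set" where
  "source (Connection x d) = {x}"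
| "source (Output x) = {x}"
| "source (Input d) = {}"

fun target :: "edge \<Rightarrow> slot set" where
  "target (Connection x d) = {d}"
| "target (Output x) = {}"
| "target (Input d) = {d}"

fun vertical :: "diagram \<Rightarrow> edge \<Rightarrow> (real \<times> real) set" where
  "vertical \<delta> (Connection x d) = {out_x \<delta> x} \<times> {gate_top \<delta> (fst x)..in_y \<delta> d}"
| "vertical \<delta> (Output x) = {out_x \<delta> x} \<times> {gate_top \<delta> (fst x)..}"
| "vertical \<delta> (Input d) = {}"

fun horizontal :: "diagram \<Rightarrow> edge \<Rightarrow> (real \<times> real) set" where
  "horizontal \<delta> (Connection x d) = {gate_right \<delta> (fst d)..out_x \<delta> x} \<times> {in_y \<delta> d}"
| "horizontal \<delta> (Output x) = {}"
| "horizontal \<delta> (Input d) = {gate_right \<delta> (fst d)..} \<times> {in_y \<delta> d}"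

lemma curve_eq: "curve \<delta> e = vertical \<delta> e \<union> horizontal \<delta> e"
  by (cases e) auto

lemma vertical_on_line: "p \<in> vertical \<delta> e \<Longrightarrow> \<exists>x\<in>source e. fst p = out_x \<delta> x"
  by (cases e) auto

lemma horizontal_on_line: "p \<in> horizontal \<delta> e \<Longrightarrow> \<exists>d\<in>target e. snd p = in_y \<delta> d"
  by (cases e) auto

text \<open>
  The conditions without a bounded quantifier are where the two lines start, at a gate; the
  quantified ones are where they stop, and are void for half-lines.
\<close>

lemma vertical_meets_horizontal_iff:
  "vertical \<delta> e \<inter> horizontal \<delta> f \<noteq> {} \<longleftrightarrow> (\<exists>x\<in>source e. \<exists>d\<in>target f.
     gate_right \<delta> (fst d) \<le> out_x \<delta> x \<and> gate_top \<delta> (fst x) \<le> in_y \<delta> d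
     \<and> (\<forall>d'\<in>target e. in_y \<delta> d \<le> in_y \<delta> d') \<and> (\<forall>x'\<in>source f. out_x \<delta> x \<le> out_x \<delta> x'))"
  by (cases e; cases f) (auto simp: Times_Int_Times)

text \<open>
  The combinatorial form of the previous condition: the vertical piece of \<open>e\<close> meets the
  horizontal piece of \<open>f\<close>.
\<close>

definition passes_over :: "edge \<Rightarrow> edge \<Rightarrow> bool" where
  "passes_over e f \<longleftrightarrow> (\<exists>x\<in>source e. \<exists>d\<in>target f. fst x < fst d
     \<and> (\<forall>d'\<in>target e. above d' d) \<and> (\<forall>x'\<in>source f. left_of x x'))"

text \<open>
  If both relations held, both edges would have a vertical line, each to the left of the other.
\<close>

lemma passes_over_asym: "passes_over e f \<Longrightarrow> \<not> passes_over f e"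
  unfolding passes_over_def by (metis slots.prec_asym precedes.simps(1))

context
  fixes \<H> n \<delta>
  assumes diagram: "\<delta> \<in> labelled_diagrams \<H> n"
begin

lemma inj_connections: "inj_on fst (connections \<delta>)" "inj_on snd (connections \<delta>)"
  using diagram unfolding labelled_diagrams_def by auto

lemma connections_subset: "connections \<delta> \<subseteq> out_slots n \<delta> \<times> in_slots n \<delta>"
  using diagram unfolding labelled_diagrams_def by auto

lemma source_out_slots: "e \<in> edges n \<delta> \<Longrightarrow> x \<in> source e \<Longrightarrow> x \<in> out_slots n \<delta>"
  using connections_subset unfolding edges_def outputs_def by auto

lemma target_in_slots: "e \<in> edges n \<delta> \<Longrightarrow> d \<in> target e \<Longrightarrow> d \<in> in_slots n \<delta>"
  using connections_subset unfolding edges_def inputs_def by auto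

lemma edge_of_source:
  "e \<in> edges n \<delta> \<Longrightarrow> f \<in> edges n \<delta> \<Longrightarrow> x \<in> source e \<Longrightarrow> x \<in> source f \<Longrightarrow> e = f"
  using inj_connections(1) unfolding edges_def outputs_def by (force simp: inj_on_def)

lemma edge_of_target:
  "e \<in> edges n \<delta> \<Longrightarrow> f \<in> edges n \<delta> \<Longrightarrow> d \<in> target e \<Longrightarrow> d \<in> target f \<Longrightarrow> e = f"
  using inj_connections(2) unfolding edges_def inputs_def by (force simp: inj_on_def)

lemma ex_edge_source: "x \<in> out_slots n \<delta> \<Longrightarrow> \<exists>e\<in>edges n \<delta>. x \<in> source e"
  unfolding edges_def outputs_def by (cases "x \<in> fst ` connections \<delta>") force+

lemma ex_edge_target: "d \<in> in_slots n \<delta> \<Longrightarrow> \<exists>e\<in>edges n \<delta>. d \<in> target e"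
  unfolding edges_def inputs_def by (cases "d \<in> snd ` connections \<delta>") force+

lemma source_target_connection:
  "e \<in> edges n \<delta> \<Longrightarrow> x \<in> source e \<Longrightarrow> d \<in> target e \<Longrightarrow> (x, d) \<in> connections \<delta>"
  unfolding edges_def by auto

lemma connection_target:
  assumes "(x, d) \<in> connections \<delta>" "e \<in> edges n \<delta>"
  shows "x \<in> source e \<Longrightarrow> d \<in> target e" "d \<in> target e \<Longrightarrow> x \<in> source e"
proof -
  have "Connection x d \<in> edges n \<delta>" using assms(1) unfolding edges_def by force
  then show "x \<in> source e \<Longrightarrow> d \<in> target e" "d \<in> target e \<Longrightarrow> x \<in> source e"
    using edge_of_source[of "Connection x d" e x] edge_of_target[of "Connection x d" e d] assms(2)
    by auto
qed

text \<open>
  Distinct edges share neither source nor target, so the weak inequalities between coordinates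
  are strict.
\<close>

lemma vertical_meets_horizontal_iff_passes_over:
  assumes e: "e \<in> edges n \<delta>" and f: "f \<in> edges n \<delta>" and "e \<noteq> f"
  shows "vertical \<delta> e \<inter> horizontal \<delta> f \<noteq> {} \<longleftrightarrow> passes_over e f"
  unfolding vertical_meets_horizontal_iff passes_over_def
proof (intro bex_cong refl)
  fix x d assume x: "x \<in> source e" and d: "d \<in> target f"
  have xs: "x \<in> out_slots n \<delta>" and ds: "d \<in> in_slots n \<delta>"
    using source_out_slots[OF e x] target_in_slots[OF f d] .
  have "1 \<le> fst x" using xs unfolding out_slots_def by auto
  moreover have "in_y \<delta> d \<le> in_y \<delta> d' \<longleftrightarrow> above d' d" if "d' \<in> target e" for d'
    using in_y_le_iff[OF ds target_in_slots[OF e that]] edge_of_target[OF e f that] d \<open>e \<noteq> f\<close>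
    by blast
  moreover have "out_x \<delta> x \<le> out_x \<delta> x' \<longleftrightarrow> left_of x x'" if "x' \<in> source f" for x'
    using out_x_le_iff[OF xs source_out_slots[OF f that]] edge_of_source[OF e f x] that \<open>e \<noteq> f\<close>
    by blast
  ultimately show "gate_right \<delta> (fst d) \<le> out_x \<delta> x \<and> gate_top \<delta> (fst x) \<le> in_y \<delta> d
     \<and> (\<forall>d'\<in>target e. in_y \<delta> d \<le> in_y \<delta> d') \<and> (\<forall>x'\<in>source f. out_x \<delta> x \<le> out_x \<delta> x')
     \<longleftrightarrow> fst x < fst d \<and> (\<forall>d'\<in>target e. above d' d) \<and> (\<forall>x'\<in>source f. left_of x x')"
    using gate_right_le_out_x_iff[OF xs] gate_top_le_in_y_iff[OF ds] by auto
qed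

lemma curves_meet_iff:
  assumes e: "e \<in> edges n \<delta>" and f: "f \<in> edges n \<delta>" and "e \<noteq> f"
  shows "curve \<delta> e \<inter> curve \<delta> f \<noteq> {} \<longleftrightarrow> passes_over e f \<or> passes_over f e"
proof -
  have "vertical \<delta> e \<inter> vertical \<delta> f = {}"
    using vertical_on_line[of _ \<delta> e] vertical_on_line[of _ \<delta> f] inj_onD[OF inj_on_out_x[of \<delta> n]]
      source_out_slots e f edge_of_source[OF e f] \<open>e \<noteq> f\<close> by (metis disjoint_iff)
  moreover have "horizontal \<delta> e \<inter> horizontal \<delta> f = {}"
    using horizontal_on_line[of _ \<delta> e] horizontal_on_line[of _ \<delta> f] inj_onD[OF inj_on_in_y[of \<delta> n]]
      target_in_slots e f edge_of_target[OF e f] \<open>e \<noteq> f\<close> by (metis disjoint_iff)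
  moreover have "curve \<delta> e \<inter> curve \<delta> f
      = (vertical \<delta> e \<inter> vertical \<delta> f) \<union> (horizontal \<delta> e \<inter> horizontal \<delta> f)
        \<union> (vertical \<delta> e \<inter> horizontal \<delta> f) \<union> (vertical \<delta> f \<inter> horizontal \<delta> e)"
    unfolding curve_eq by blast
  ultimately show ?thesis
    using vertical_meets_horizontal_iff_passes_over[OF e f]
      vertical_meets_horizontal_iff_passes_over[OF f e] \<open>e \<noteq> f\<close> by auto
qed

text \<open>
  Asymmetry lets each crossing pair of edges be ordered in a unique way.
\<close>

lemma crossings_eq_card_passes_over:
  "crossings n \<delta> = card {(e, f). e \<in> edges n \<delta> \<and> f \<in> edges n \<delta> \<and> passes_over e f}" (is "_ = card ?P")
proof -
  have "{{e, f} | e f. e \<in> edges n \<delta> \<and> f \<in> edges n \<delta> \<and> e \<noteq> f \<and> curve \<delta> e \<inter> curve \<delta> f \<noteq> {}}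
      = (\<lambda>(e, f). {e, f}) ` ?P" (is "?L = ?R")
  proof (intro subset_antisym subsetI)
    fix c assume "c \<in> ?L"
    then obtain e f where "c = {e, f}" "e \<in> edges n \<delta>" "f \<in> edges n \<delta>"
      "passes_over e f \<or> passes_over f e" using curves_meet_iff by blast
    then show "c \<in> ?R" by (auto simp: insert_commute intro: rev_image_eqI)
  next
    fix c assume "c \<in> ?R"
    then obtain e f where "c = {e, f}" "e \<in> edges n \<delta>" "f \<in> edges n \<delta>" "passes_over e f" by auto
    moreover from this have "e \<noteq> f" using passes_over_asym by blast
    ultimately show "c \<in> ?L" using curves_meet_iff[of e f] by blast
  qed
  moreover have "inj_on (\<lambda>(e, f). {e, f}) ?P"
    by (rule inj_onI) (auto simp: doubleton_eq_iff dest: passes_over_asym)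
  ultimately show ?thesis unfolding crossings_def by (simp add: card_image)
qed

text \<open>
  An edge is determined by its output slot, if it has one, and likewise by its input slot, and
  each slot lies on an edge.  So the ordered pair of edges may be replaced by the output slot of
  the one and the input slot of the other.
\<close>

lemma crossings_eq_card_cross_pairs:
  "crossings n \<delta> = card (slots.cross_pairs (set (slot_list (gate_type \<delta>) n)) (connections \<delta>))"
    (is "_ = card ?C")
proof -
  let ?P = "{(e, f). e \<in> edges n \<delta> \<and> f \<in> edges n \<delta> \<and> passes_over e f}"
  let ?g = "\<lambda>(e, f). (the_elem (source e), the_elem (target f))"
  have the: "x \<in> source e \<Longrightarrow> the_elem (source e) = x" "d \<in> target e \<Longrightarrow> the_elem (target e) = d"
    for e x d by (cases e; simp)+
  have P: "\<exists>x d. x \<in> source e \<and> d \<in> target f \<and> fst x < fst d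
      \<and> (\<forall>d'\<in>target e. above d' d) \<and> (\<forall>x'\<in>source f. left_of x x')" if "passes_over e f" for e f
    using that unfolding passes_over_def by blast
  have "bij_betw ?g ?P ?C"
    unfolding bij_betw_def
  proof (intro conjI subset_antisym subsetI inj_onI)
    fix u v assume u: "u \<in> ?P" and v: "v \<in> ?P" and eq: "?g u = ?g v"
    obtain e f e' f' where uv: "u = (e, f)" "v = (e', f')" by (metis surj_pair)
    then obtain x d where "x \<in> source e" "d \<in> target f" using u P by blast
    moreover obtain x' d' where "x' \<in> source e'" "d' \<in> target f'" using v uv P by blast
    ultimately show "u = v"
      using u v uv eq the edge_of_source[of e e' x] edge_of_target[of f f' d] by auto
  next
    fix p assume "p \<in> ?g ` ?P"
    then obtain e f where ef: "e \<in> edges n \<delta>" "f \<in> edges n \<delta>" "passes_over e f" and p: "p = ?g (e, f)"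
      by blast
    obtain x d where x: "x \<in> source e" and d: "d \<in> target f" and c: "fst x < fst d"
      "\<forall>d'\<in>target e. above d' d" "\<forall>x'\<in>source f. left_of x x'" using P[OF ef(3)] by blast
    have "p = (x, d)" using p the(1)[OF x] the(2)[OF d] by simp
    then show "p \<in> ?C"
      unfolding slots.cross_pairs_def
      using c source_out_slots[OF ef(1) x] target_in_slots[OF ef(2) d]
        connection_target(1)[OF _ ef(1) x] connection_target(2)[OF _ ef(2) d] by auto
  next
    fix p assume "p \<in> ?C"
    then obtain x d where p: "p = (x, d)" "x \<in> out_slots n \<delta>" "d \<in> in_slots n \<delta>" "fst x < fst d"
      "\<And>d'. (x, d') \<in> connections \<delta> \<Longrightarrow> above d' d"
      "\<And>x'. (x', d) \<in> connections \<delta> \<Longrightarrow> left_of x x'"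
      unfolding slots.cross_pairs_def by auto
    obtain e f where ef: "e \<in> edges n \<delta>" "x \<in> source e" "f \<in> edges n \<delta>" "d \<in> target f"
      using ex_edge_source[OF p(2)] ex_edge_target[OF p(3)] by blast
    have "passes_over e f"
      unfolding passes_over_def using p ef source_target_connection by blast
    then have "(e, f) \<in> ?P" using ef by blast
    moreover have "p = ?g (e, f)" using p(1) the(1)[OF ef(2)] the(2)[OF ef(4)] by simp
    ultimately show "p \<in> ?g ` ?P" by (rule rev_image_eqI)
  qed
  then show ?thesis unfolding crossings_eq_card_passes_over by (rule bij_betw_same_card)
qed

end


section \<open>Coefficients of the powers\<close>

theorem theorem2:
  fixes \<H> :: "(nat \<times> nat) set"
    and w :: "nat \<times> nat \<Rightarrow> 'a::comm_ring_1"
    and h :: "'a op_poly"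
    and n a b :: nat
  assumes "finite \<H>"
    and "normal_form h = (\<Sum>(r, s)\<in>\<H>. scalar [:w (r, s):] * opX ^ r * opD ^ s)"
  shows "nf_coeff (h ^ n) a b =
    (\<Sum>\<delta> | \<delta> \<in> labelled_diagrams \<H> n \<and> card (outputs n \<delta>) = a \<and> card (inputs n \<delta>) = b.
       smult (weight w n \<delta>) (qvar ^ crossings n \<delta>))"
proof -
  let ?S = "\<lambda>\<gamma>. set (slot_list \<gamma> n)"
  have fin: "finite ({1..n} \<rightarrow>\<^sub>E \<H>)" by (rule finite_PiE) (use assms(1) in auto)
  have N: "normal_form h = (\<Sum>(r, s)\<in>\<H>. Poly_Mapping.single (normal_word r s) [:w (r, s):])"
    unfolding assms(2)
    by (simp add: mult.assoc opX_opD_power scalar_def mult_single)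
  have "nf_coeff (h ^ n) a b
      = (\<Sum>\<gamma>\<in>{1..n} \<rightarrow>\<^sub>E \<H>. [:\<Prod>j\<in>{1..n}. w (\<gamma> j):] * word_coeff (map fst (slot_list \<gamma> n)) a b)"
    unfolding nf_coeff_eq_inv_coeff inv_coeff_normal_form_power N power_sum_normal_words
      inv_coeff_sum inv_coeff_single by simp
  also have "\<dots> = (\<Sum>\<gamma>\<in>{1..n} \<rightarrow>\<^sub>E \<H>. \<Sum>C\<in>slots.matchings (?S \<gamma>).
      smult (\<Prod>j\<in>{1..n}. w (\<gamma> j)) (slots.matching_term a b (?S \<gamma>) C))"
    by (simp add: slots.word_coeff_eq_sum_matchings[OF sorted_slot_list] sum_distrib_left)
  also have "\<dots> = (\<Sum>\<delta>\<in>labelled_diagrams \<H> n.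
      smult (weight w n \<delta>) (slots.matching_term a b (?S (gate_type \<delta>)) (connections \<delta>)))"
    unfolding labelled_diagrams_eq_Sigma weight_def
    by (subst sum.Sigma[OF fin]) (auto simp: slots.finite_matchings intro!: sum.cong)
  also have "\<dots> = (\<Sum>\<delta>\<in>labelled_diagrams \<H> n. if card (outputs n \<delta>) = a \<and> card (inputs n \<delta>) = b
      then smult (weight w n \<delta>) (qvar ^ crossings n \<delta>) else 0)"
  proof (rule sum.cong[OF refl])
    fix \<delta> assume \<delta>: "\<delta> \<in> labelled_diagrams \<H> n"
    show "smult (weight w n \<delta>) (slots.matching_term a b (?S (gate_type \<delta>)) (connections \<delta>))
      = (if card (outputs n \<delta>) = a \<and> card (inputs n \<delta>) = b
          then smult (weight w n \<delta>) (qvar ^ crossings n \<delta>) else 0)"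
      by (simp add: slots.matching_term_def slots.free_def crossings_eq_card_cross_pairs[OF \<delta>]
          outputs_def inputs_def)
  qed
  also have "\<dots> = (\<Sum>\<delta> | \<delta> \<in> labelled_diagrams \<H> n
        \<and> card (outputs n \<delta>) = a \<and> card (inputs n \<delta>) = b.
      smult (weight w n \<delta>) (qvar ^ crossings n \<delta>))"
    by (rule sum.inter_filter[symmetric])
      (unfold labelled_diagrams_eq_Sigma, intro finite_SigmaI fin slots.finite_matchings, simp)
  finally show ?thesis .
qed

end
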